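(* Let $J,K,N$ be positive integers, $\bar P>0$, let $\boldsymbol{\beta},\mathbf{w},\boldsymbol{\sigma}\in\mathbb{R}_{++}^{JK}$, and let $d_{m,n}>0$ for $m,n\in\{1,\dots,JK\}$. For given $\hat{\mathbf{q}},\hat{\boldsymbol{\phi}}\in\mathbb{R}_{++}^{JK}$, put $$\hat\phi_m'=\frac{-\hat\phi_m}{w_m+\frac1N\sum_{n\ne m}\frac{\hat q_n d_{m,n}}{(1+\hat q_n d_{m,n}\hat\phi_m)^2}}\qquad(m=1,\dots,JK),$$ and consider the optimization problem $$\text{maximize}\quad \min_m\ \frac{\hat p_m d_{m,m}\frac{\hat\phi_m^2}{-\hat\phi_m'}}{\beta_m\Big(\sigma_m+\frac1N\sum_{n\ne m}\frac{\hat p_n d_{n,m}}{(1+\hat q_m d_{n,m}\hat\phi_n)^2}\Big)}\qquad\text{subject to}\quad \tfrac1N\mathbf{w}^{\mathsf T}\hat{\mathbf{p}}\le\bar P,\ \ \hat{\mathbf{p}}>0,$$ in the variable $\hat{\mathbf{p}}\in\mathbb{R}^{JK}$. Starting from any initial $\hat{\mathbf{p}}[0]\in\mathbb{R}_{++}^{JK}$ with $\frac1N\mathbf{w}^{\mathsf T}\hat{\mathbf{p}}[0]\le\bar P$, define for $\ell=0,1,2,\dots$: 1. $\hat p_m[\ell+1]=\dfrac{-\hat\phi_m'\beta_m}{\hat\phi_m^2 d_{m,m}}\Big(\sigma_m+\frac1N\sum_{n\ne m}\dfrac{\hat p_n[\ell]d_{n,m}}{(1+\hat q_m d_{n,m}\hat\phi_n)^2}\Big)$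 for all $m$; 2. replace $\hat{\mathbf{p}}[\ell+1]$ by $\dfrac{N\bar P}{\mathbf{w}^{\mathsf T}\hat{\mathbf{p}}[\ell+1]}\,\hat{\mathbf{p}}[\ell+1]$. Then $\hat{\mathbf{p}}[\ell]$ converges geometrically fast, as $\ell\to\infty$, to the optimal solution $\hat{\mathbf{p}}^*(\hat{\mathbf{q}},\hat{\boldsymbol{\phi}})$ of the optimization problem.
   Context: $\mathbb{R}_{++}$ denotes the positive reals; sums over $n\neq m$ run over $n\in\{1,\dots,JK\}\setminus\{m\}$. A sequence $x[\ell]$ converges geometrically fast to $x^*$ if there are constants $C>0$ and $r\in(0,1)$ with $\|x[\ell]-x^*\|\le C r^{\ell}$ for all $\ell$. *)

theory Defs
  imports "HOL-Analysis.Analysis"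
begin

definition positive_vec :: "real ^ 'n \<Rightarrow> bool" where
  "positive_vec x \<longleftrightarrow> (\<forall>m. 0 < x $ m)"

definition phi_deriv ::
  "nat \<Rightarrow> real ^ 'n \<Rightarrow> real ^ 'n ^ 'n \<Rightarrow> real ^ 'n \<Rightarrow> real ^ 'n \<Rightarrow> real ^ 'n::finite" where
  "phi_deriv N w d q \<phi> =
     (\<chi> m. - \<phi> $ m /
       (w $ m + 1 / real N *
         (\<Sum>n\<in>UNIV - {m}. q $ n * d $ m $ n / (1 + q $ n * d $ m $ n * \<phi> $ m)\<^sup>2)))"

(* The indices of d are transposed here relative to phi_deriv. *)
definition interference ::
  "nat \<Rightarrow> real ^ 'n \<Rightarrow> real ^ 'n ^ 'n \<Rightarrow> real ^ 'n \<Rightarrow> real ^ 'n \<Rightarrow> real ^ 'n \<Rightarrow> 'n::finite \<Rightarrow> real" where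
  "interference N \<sigma> d q \<phi> p m =
     \<sigma> $ m + 1 / real N *
       (\<Sum>n\<in>UNIV - {m}. p $ n * d $ n $ m / (1 + q $ m * d $ n $ m * \<phi> $ n)\<^sup>2)"

definition objective ::
  "nat \<Rightarrow> real ^ 'n \<Rightarrow> real ^ 'n \<Rightarrow> real ^ 'n \<Rightarrow> real ^ 'n ^ 'n \<Rightarrow> real ^ 'n \<Rightarrow> real ^ 'n
    \<Rightarrow> real ^ 'n::finite \<Rightarrow> real" where
  "objective N \<beta> w \<sigma> d q \<phi> p =
     Min (range (\<lambda>m. p $ m * d $ m $ m * ((\<phi> $ m)\<^sup>2 / - phi_deriv N w d q \<phi> $ m) /
                      (\<beta> $ m * interference N \<sigma> d q \<phi> p m)))"

definition feasible :: "nat \<Rightarrow> real \<Rightarrow> real ^ 'n \<Rightarrow> real ^ 'n::finite \<Rightarrow> bool" where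
  "feasible N P w p \<longleftrightarrow> 1 / real N * (w \<bullet> p) \<le> P \<and> positive_vec p"

definition power_update ::
  "nat \<Rightarrow> real ^ 'n \<Rightarrow> real ^ 'n \<Rightarrow> real ^ 'n \<Rightarrow> real ^ 'n ^ 'n \<Rightarrow> real ^ 'n \<Rightarrow> real ^ 'n
    \<Rightarrow> real ^ 'n \<Rightarrow> real ^ 'n::finite" where
  "power_update N \<beta> w \<sigma> d q \<phi> p =
     (\<chi> m. - phi_deriv N w d q \<phi> $ m * \<beta> $ m / ((\<phi> $ m)\<^sup>2 * d $ m $ m) *
            interference N \<sigma> d q \<phi> p m)"

definition rescale :: "nat \<Rightarrow> real \<Rightarrow> real ^ 'n \<Rightarrow> real ^ 'n \<Rightarrow> real ^ 'n::finite" where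
  "rescale N P w p = (real N * P / (w \<bullet> p)) *\<^sub>R p"

definition converges_geometrically ::
  "(nat \<Rightarrow> 'a::real_normed_vector) \<Rightarrow> 'a \<Rightarrow> bool" where
  "converges_geometrically x L \<longleftrightarrow>
     (\<exists>C>0. \<exists>r\<in>{0<..<1}. \<forall>l. norm (x l - L) \<le> C * r ^ l)"

end

theory Submission
  imports Defs
begin

text \<open>
  On the hyperplane \<open>w \<bullet> p = N P\<close> the constant noise term can be absorbed into the linear part, so
  the affine update agrees there with a matrix \<open>B\<close> all of whose entries are positive. The iteration
  is thus the normalised power iteration of \<open>B\<close>, and the optimum is its Perron vector \<open>v\<close>
  (obtained from Brouwer's theorem). In the coordinates \<open>p\<^sub>m / v\<^sub>m\<close> the matrix \<open>B\<close> becomes, up to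
  its eigenvalue, a stochastic matrix with positive entries, which shrinks the range of the
  coordinates by a fixed factor.
  The objective is \<open>min\<^sub>m p\<^sub>m / T(p)\<^sub>m\<close> with \<open>T\<close> the update, so a feasible competitor at least as
  good as \<open>v\<close> satisfies \<open>B x \<le> \<lambda> x\<close>, which forces it to be a multiple of \<open>v\<close>.
\<close>

section \<open>Perron vectors of positive matrices\<close>

lemma positive_vec_inner_pos:
  fixes w x :: "real ^ 'n::finite"
  assumes "positive_vec w" "positive_vec x"
  shows "0 < w \<bullet> x"
  using assms by (auto simp: positive_vec_def inner_vec_def intro!: sum_pos)

lemma matrix_vector_mult_pos:
  fixes B :: "real ^ 'n ^ 'm::finite" and x :: "real ^ 'n::finite"
  assumes "\<And>i j. 0 < B $ i $ j" and "\<And>j. 0 \<le> x $ j" and "x \<noteq> 0"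
  shows "positive_vec (B *v x)"
proof -
  obtain k where k: "x $ k \<noteq> 0"
    using assms(3) by (auto simp: vec_eq_iff)
  have "0 < (\<Sum>j\<in>UNIV. B $ i $ j * x $ j)" for i
  proof (rule sum_pos2)
    show "0 < B $ i $ k * x $ k"
      using assms(1)[of i k] assms(2)[of k] k by simp
  qed (use assms(2) less_imp_le[OF assms(1)] in auto)
  then show ?thesis
    by (simp add: positive_vec_def matrix_vector_mult_def)
qed

text \<open>On the compact convex slice \<open>S\<close> of the nonnegative orthant, the normalised
  map \<open>f\<close> is continuous and maps \<open>S\<close> into itself, so Brouwer gives a fixed
  point \<open>v\<close>. Undoing the normalisation yields the eigenvalue
  \<open>w \<bullet> (B *v v) / c\<close>, and \<open>v\<close> is positive because \<open>B\<close>
  maps all of \<open>S\<close> to positive vectors.\<close>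

lemma positive_matrix_perron_vector:
  fixes B :: "real ^ 'n ^ 'n::finite" and w :: "real ^ 'n"
  assumes B: "\<And>i j. 0 < B $ i $ j" and w: "positive_vec w" and c: "0 < c"
  obtains v \<mu> where "positive_vec v" "0 < \<mu>" "w \<bullet> v = c" "B *v v = \<mu> *\<^sub>R v"
proof -
  define S where "S = {x. \<forall>m. 0 \<le> x $ m} \<inter> {x. w \<bullet> x = c}"
  define f where "f = (\<lambda>x. (c / (w \<bullet> (B *v x))) *\<^sub>R (B *v x))"
  have w0: "0 < w $ m" for m
    using w by (simp add: positive_vec_def)
  have pos: "positive_vec (B *v x)" if "x \<in> S" for x
    using that c by (intro matrix_vector_mult_pos B) (auto simp: S_def)
  have wpos: "0 < w \<bullet> (B *v x)" if "x \<in> S" for x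
    by (rule positive_vec_inner_pos[OF w pos[OF that]])
  have "bounded S"
    unfolding bounded_iff
  proof (intro exI ballI)
    fix x assume x: "x \<in> S"
    have "x $ m \<le> c / w $ m" for m
    proof -
      have "w $ m * x $ m \<le> (\<Sum>i\<in>UNIV. w $ i * x $ i)"
        using x w0 by (intro member_le_sum) (auto simp: S_def less_imp_le)
      also have "\<dots> = c"
        using x by (simp add: S_def inner_vec_def)
      finally show ?thesis
        using w0[of m] by (simp add: field_simps)
    qed
    then have "(\<Sum>m\<in>UNIV. \<bar>x $ m\<bar>) \<le> (\<Sum>m\<in>UNIV. c / w $ m)"
      using x by (intro sum_mono) (auto simp: S_def)
    then show "norm x \<le> (\<Sum>m\<in>UNIV. c / w $ m)"
      using norm_le_l1_cart[of x] by linarith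
  qed
  moreover have "closed S"
    unfolding S_def
    by (intro closed_Int closed_Collect_all closed_Collect_le closed_Collect_eq continuous_intros)
  ultimately have "compact S"
    by (simp add: compact_eq_bounded_closed)
  moreover have "convex S"
    unfolding convex_def S_def
    by (auto simp: inner_add_right simp flip: distrib_right)
  moreover have "S \<noteq> {}"
  proof -
    define e :: "real ^ 'n" where "e = (\<chi> m. 1)"
    have "0 < w \<bullet> e"
      by (rule positive_vec_inner_pos[OF w]) (simp add: positive_vec_def e_def)
    then have "(c / (w \<bullet> e)) *\<^sub>R e \<in> S"
      using c by (auto simp: S_def e_def)
    then show ?thesis by blast
  qed
  moreover have "continuous_on S f"
    unfolding f_def using wpos
    by (intro continuous_intros linear_continuous_on_compose[OF continuous_on_id]
        matrix_vector_mul_linear) (force)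
  moreover have "f \<in> S \<rightarrow> S"
  proof
    fix x assume x: "x \<in> S"
    have "0 \<le> f x $ m" for m
      using pos[OF x] wpos[OF x] c by (simp add: f_def positive_vec_def less_imp_le)
    moreover have "w \<bullet> f x = c"
      using wpos[OF x] by (simp add: f_def)
    ultimately show "f x \<in> S"
      by (simp add: S_def)
  qed
  ultimately obtain v where v: "v \<in> S" "f v = v"
    by (rule brouwer)
  show thesis
  proof
    show "positive_vec v"
      using pos[OF v(1)] wpos[OF v(1)] c v(2)[symmetric]
      by (auto simp: f_def positive_vec_def vec_eq_iff)
    show "0 < w \<bullet> (B *v v) / c"
      using wpos[OF v(1)] c by simp
    show "w \<bullet> v = c"
      using v(1) by (simp add: S_def)
    have "(w \<bullet> (B *v v) / c) *\<^sub>R f v = B *v v"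
      using wpos[OF v(1)] c by (simp add: f_def)
    then show "B *v v = (w \<bullet> (B *v v) / c) *\<^sub>R v"
      using v(2) by simp
  qed
qed

text \<open>Subtract from \<open>x\<close> the largest multiple of \<open>v\<close> lying below it.
  The difference is nonnegative and vanishes at some coordinate \<open>k\<close>. If it were
  nonzero, \<open>B\<close> would make it positive at \<open>k\<close>, against the assumed
  inequality there.\<close>

lemma subeigenvector_multiple_of_perron_vector:
  fixes B :: "real ^ 'n ^ 'n::finite"
  assumes B: "\<And>i j. 0 < B $ i $ j"
    and v: "positive_vec v" "B *v v = \<mu> *\<^sub>R v"
    and x: "\<And>m. (B *v x) $ m \<le> \<mu> * x $ m"
  obtains s where "x = s *\<^sub>R v"
proof -
  have v0: "0 < v $ m" for m
    using v(1) by (simp add: positive_vec_def)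
  define s where "s = Min (range (\<lambda>m. x $ m / v $ m))"
  have "s \<in> range (\<lambda>m. x $ m / v $ m)"
    unfolding s_def by (intro Min_in) auto
  then obtain k where "s = x $ k / v $ k" by blast
  then have k: "x $ k = s * v $ k"
    using v0[of k] by simp
  have "s \<le> x $ m / v $ m" for m
    unfolding s_def by (intro Min_le) auto
  then have le: "s * v $ m \<le> x $ m" for m
    by (simp add: pos_le_divide_eq v0)
  have "x - s *\<^sub>R v = 0"
  proof (rule ccontr)
    assume "x - s *\<^sub>R v \<noteq> 0"
    then have "positive_vec (B *v (x - s *\<^sub>R v))"
      using le by (intro matrix_vector_mult_pos B) auto
    then have "0 < (B *v (x - s *\<^sub>R v)) $ k"
      by (simp add: positive_vec_def)
    then show False
      using x[of k] k v(2)
      by (simp add: matrix_vector_mult_diff_distrib matrix_vector_mult_scaleR mult_ac)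
  qed
  then show thesis
    using that[of s] by simp
qed

section \<open>Geometric convergence of the normalised power iteration\<close>

text \<open>The numbers \<open>C $ i $ j * v $ j / v $ i\<close> form a stochastic matrix with
  entries at least \<open>\<delta>\<close>, so every new ratio to \<open>v\<close> is an average
  giving weight at least \<open>\<delta>\<close> to the old ratio \<open>u\<close> at
  \<open>k\<close>. The lower bound rises by \<open>\<delta> * (u - a)\<close> and the upper one
  falls by \<open>\<delta> * (b - u)\<close>; the total gain does not depend on
  \<open>u\<close>.\<close>

lemma positive_matrix_bounds_contract:
  fixes C :: "real ^ 'n ^ 'n::finite" and k :: 'n
  assumes v: "positive_vec v" "C *v v = v"
    and \<delta>: "0 \<le> \<delta>" "\<And>i j. \<delta> * v $ i \<le> C $ i $ j * v $ j"
    and C: "\<And>i j. 0 \<le> C $ i $ j"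
    and ab: "\<And>m. a * v $ m \<le> z $ m" "\<And>m. z $ m \<le> b * v $ m"
  obtains a' b' where "a \<le> a'" "b' - a' = (1 - \<delta>) * (b - a)"
    "\<And>m. a' * v $ m \<le> (C *v z) $ m" "\<And>m. (C *v z) $ m \<le> b' * v $ m"
proof -
  have v0: "0 < v $ m" for m
    using v(1) by (simp add: positive_vec_def)
  define u where "u = z $ k / v $ k"
  have zk: "z $ k = u * v $ k"
    using v0[of k] by (simp add: u_def)
  have u: "a \<le> u" "u \<le> b"
    using ab[of k] v0[of k] by (auto simp: zk)
  \<comment> \<open>Only the \<open>k\<close>-th term of the row sum is kept. Both bounds follow,
    with \<open>y\<close> taken as \<open>z - a *\<^sub>R v\<close> and as
    \<open>b *\<^sub>R v - z\<close>.\<close>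
  have low: "\<delta> * t * v $ m \<le> (C *v y) $ m"
    if "\<And>j. 0 \<le> y $ j" "y $ k = t * v $ k" "0 \<le> t" for y t m
  proof -
    have "\<delta> * t * v $ m = t * (\<delta> * v $ m)" by simp
    also have "\<dots> \<le> t * (C $ m $ k * v $ k)"
      by (intro mult_left_mono \<delta> that)
    also have "\<dots> = C $ m $ k * y $ k"
      by (simp add: that)
    also have "\<dots> \<le> (\<Sum>j\<in>UNIV. C $ m $ j * y $ j)"
      using C that(1) by (intro member_le_sum) auto
    finally show ?thesis
      by (simp add: matrix_vector_mult_def)
  qed
  show thesis
  proof
    show "a \<le> a + \<delta> * (u - a)"
      using u \<delta>(1) by simp
    show "b - \<delta> * (b - u) - (a + \<delta> * (u - a)) = (1 - \<delta>) * (b - a)"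
      by (simp add: algebra_simps)
    fix m
    show "(a + \<delta> * (u - a)) * v $ m \<le> (C *v z) $ m"
      using low[of "z - a *\<^sub>R v" "u - a" m] ab u zk v(2)
      by (simp add: matrix_vector_mult_diff_distrib matrix_vector_mult_scaleR algebra_simps)
    show "(C *v z) $ m \<le> (b - \<delta> * (b - u)) * v $ m"
      using low[of "b *\<^sub>R v - z" "b - u" m] ab u zk v(2)
      by (simp add: matrix_vector_mult_diff_distrib matrix_vector_mult_scaleR algebra_simps)
  qed
qed

lemma normalised_power_iteration_converges:
  fixes B :: "real ^ 'n ^ 'n::finite" and x :: "nat \<Rightarrow> real ^ 'n"
  assumes B: "\<And>i j. 0 < B $ i $ j" and w: "positive_vec w" and c: "0 < c"
    and v: "positive_vec v" "0 < \<mu>" "w \<bullet> v = c" "B *v v = \<mu> *\<^sub>R v"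
    and x0: "positive_vec (x 0)" "w \<bullet> x 0 = c"
    and x: "\<And>l. x (Suc l) = (c / (w \<bullet> (B *v x l))) *\<^sub>R (B *v x l)"
  shows "converges_geometrically x v"
proof -
  have v0: "0 < v $ m" and w0: "0 < w $ m" for m
    using v(1) w by (auto simp: positive_vec_def)
  define C where "C = (1 / \<mu>) *\<^sub>R B"
  have C0: "0 < C $ i $ j" for i j
    using B v(2) by (simp add: C_def)
  have CB: "C *v y = (1 / \<mu>) *\<^sub>R (B *v y)" for y
    by (simp add: C_def scaleR_matrix_vector_assoc)
  have Cv: "C *v v = v"
    using v(2,4) by (simp add: CB)
  \<comment> \<open>The cap 1/2 matters only in dimension one, where the single stochastic entry is
    1 and the rate \<open>1 - \<delta>\<close> would be 0.\<close>
  define \<delta> where "\<delta> = min (1/2) (Min (range (\<lambda>(i, j). C $ i $ j * v $ j / v $ i)))"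
  have \<delta>: "0 < \<delta>" "\<delta> < 1"
    using C0 v0 by (auto simp: \<delta>_def)
  have "\<delta> \<le> C $ i $ j * v $ j / v $ i" for i j
    unfolding \<delta>_def by (intro min.coboundedI2 Min_le) (auto intro: image_eqI[of _ _ "(i, j)"])
  then have \<delta>C: "\<delta> * v $ i \<le> C $ i $ j * v $ j" for i j
    by (simp add: pos_le_divide_eq v0)
  \<comment> \<open>Normalisation commutes with the linear map up to a scalar, so the contraction is
    run on unnormalised iterates and the scaling is restored in \<open>xz\<close>.\<close>
  define z where "z = (\<lambda>l. ((\<lambda>y. C *v y) ^^ l) (x 0))"
  have zS: "z (Suc l) = C *v z l" for l
    by (simp add: z_def)
  define a where "a = Min (range (\<lambda>m. x 0 $ m / v $ m))"
  define b where "b = Max (range (\<lambda>m. x 0 $ m / v $ m))"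
  have a: "0 < a"
    using v0 x0(1) by (auto simp: a_def positive_vec_def)
  have "a \<le> x 0 $ m / v $ m" "x 0 $ m / v $ m \<le> b" for m
    unfolding a_def b_def by auto
  then have a0: "a * v $ m \<le> x 0 $ m" and b0: "x 0 $ m \<le> b * v $ m" for m
    by (simp_all add: pos_le_divide_eq pos_divide_le_eq v0)
  \<comment> \<open>Carrying \<open>a \<le> a'\<close> along keeps \<open>w \<bullet> z l\<close> at
    least \<open>a * c\<close>, uniformly in \<open>l\<close>.\<close>
  have bounds: "\<exists>a' b'. a \<le> a' \<and> b' - a' = (1 - \<delta>) ^ l * (b - a) \<and>
      (\<forall>m. a' * v $ m \<le> z l $ m \<and> z l $ m \<le> b' * v $ m)" for l
  proof (induction l)
    case 0
    show ?case
      using a0 b0 by (intro exI[of _ a] exI[of _ b]) (simp add: z_def)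
  next
    case (Suc l)
    then obtain a' b' where IH: "a \<le> a'" "b' - a' = (1 - \<delta>) ^ l * (b - a)"
      "\<And>m. a' * v $ m \<le> z l $ m" "\<And>m. z l $ m \<le> b' * v $ m"
      by blast
    obtain a'' b'' where "a' \<le> a''" "b'' - a'' = (1 - \<delta>) * (b' - a')"
      "\<And>m. a'' * v $ m \<le> (C *v z l) $ m" "\<And>m. (C *v z l) $ m \<le> b'' * v $ m"
      using positive_matrix_bounds_contract[OF v(1) Cv less_imp_le[OF \<delta>(1)] \<delta>C
          less_imp_le[OF C0] IH(3,4)] by blast
    then show ?case
      using IH by (intro exI[of _ a''] exI[of _ b'']) (simp add: zS)
  qed
  have inner_mono: "w \<bullet> y \<le> w \<bullet> y'" if "\<And>m. y $ m \<le> y' $ m" for y y'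
    using that w0 by (auto simp: inner_vec_def less_imp_le intro!: sum_mono mult_left_mono)
  have wz: "0 < w \<bullet> z l" for l
  proof -
    have "0 < z l $ m" for m
    proof -
      obtain a' where "a \<le> a'" "a' * v $ m \<le> z l $ m"
        using bounds[of l] by blast
      then show ?thesis
        using a mult_pos_pos[of a' "v $ m"] v0[of m] by linarith
    qed
    then show ?thesis
      by (intro positive_vec_inner_pos w) (simp add: positive_vec_def)
  qed
  have xz: "x l = (c / (w \<bullet> z l)) *\<^sub>R z l" for l
  proof (induction l)
    case 0
    show ?case using x0(2) c by (simp add: z_def)
  next
    case (Suc l)
    have "B *v x l = (c / (w \<bullet> z l) * \<mu>) *\<^sub>R z (Suc l)"
      using v(2) by (simp add: Suc zS CB matrix_vector_mult_scaleR)
    then show ?case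
      using c wz[of l] v(2) by (simp add: x)
  qed
  have comp: "\<bar>x l $ m - v $ m\<bar> \<le> (b - a) / a * v $ m * (1 - \<delta>) ^ l" for l m
  proof -
    obtain a' b' where h: "a \<le> a'" "b' - a' = (1 - \<delta>) ^ l * (b - a)"
      "\<And>m. a' * v $ m \<le> z l $ m" "\<And>m. z l $ m \<le> b' * v $ m"
      using bounds[of l] by blast
    have W: "a' * c \<le> w \<bullet> z l" "w \<bullet> z l \<le> b' * c"
      using inner_mono[of "a' *\<^sub>R v" "z l"] inner_mono[of "z l" "b' *\<^sub>R v"] h v(3) by auto
    have aW: "a * c \<le> w \<bullet> z l"
      using W(1) mult_right_mono[OF h(1), of c] c by linarith
    have 1: "c * (a' * v $ m) \<le> c * z l $ m" "c * z l $ m \<le> c * (b' * v $ m)"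
      using h(3,4) c by simp_all
    have 2: "a' * c * v $ m \<le> (w \<bullet> z l) * v $ m" "(w \<bullet> z l) * v $ m \<le> b' * c * v $ m"
      using W v0[of m] by simp_all
    \<comment> \<open>Both terms of the difference lie between \<open>a' * c * v $ m\<close> and
      \<open>b' * c * v $ m\<close>.\<close>
    have "\<bar>c * z l $ m - (w \<bullet> z l) * v $ m\<bar> \<le> (b' - a') * c * v $ m"
      using 1 2 by (simp add: abs_le_iff algebra_simps)
    moreover have "x l $ m - v $ m = (c * z l $ m - (w \<bullet> z l) * v $ m) / (w \<bullet> z l)"
      using wz[of l] by (simp add: xz field_simps)
    ultimately have "\<bar>x l $ m - v $ m\<bar> \<le> (b' - a') * c * v $ m / (w \<bullet> z l)"
      using wz[of l] by (simp add: abs_divide divide_right_mono)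
    also have "\<dots> \<le> (b' - a') * c * v $ m / (a * c)"
    proof -
      have "a' * v $ m \<le> b' * v $ m"
        using h(3,4) order_trans by blast
      then have "a' \<le> b'"
        using v0[of m] by simp
      then show ?thesis
        using aW a c v0[of m] wz[of l] by (intro divide_left_mono) auto
    qed
    also have "\<dots> = (b - a) / a * v $ m * (1 - \<delta>) ^ l"
      using c a by (simp add: h(2))
    finally show ?thesis .
  qed
  define D where "D = (\<Sum>m\<in>UNIV. (b - a) / a * v $ m)"
  have "norm (x l - v) \<le> D * (1 - \<delta>) ^ l" for l
  proof -
    have "norm (x l - v) \<le> (\<Sum>m\<in>UNIV. \<bar>(x l - v) $ m\<bar>)"
      by (rule norm_le_l1_cart)
    also have "\<dots> \<le> D * (1 - \<delta>) ^ l"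
      unfolding D_def sum_distrib_right using comp by (intro sum_mono) simp
    finally show ?thesis .
  qed
  \<comment> \<open>\<open>D\<close> is 0 when the iteration starts at \<open>v\<close>, whereas a
    positive constant is required.\<close>
  moreover have "D * (1 - \<delta>) ^ l \<le> (\<bar>D\<bar> + 1) * (1 - \<delta>) ^ l" for l
    using \<delta> by (intro mult_right_mono) auto
  ultimately have "norm (x l - v) \<le> (\<bar>D\<bar> + 1) * (1 - \<delta>) ^ l" for l
    using order_trans by blast
  then show ?thesis
    unfolding converges_geometrically_def using \<delta>
    by (intro exI[of _ "\<bar>D\<bar> + 1"] conjI bexI[of _ "1 - \<delta>"]) auto
qed

lemma converges_geometrically_Suc:
  assumes "converges_geometrically (\<lambda>l. x (Suc l)) L"
  shows "converges_geometrically x L"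
proof -
  obtain C r where C: "0 < C" and r: "0 < r" "r < 1"
    and *: "\<And>l. norm (x (Suc l) - L) \<le> C * r ^ l"
    using assms by (auto simp: converges_geometrically_def)
  \<comment> \<open>The factor \<open>1 / r\<close> pays for the index shift; the second argument of
    \<open>max\<close> covers \<open>l = 0\<close>.\<close>
  have "norm (x l - L) \<le> max (C / r) (norm (x 0 - L)) * r ^ l" for l
  proof (cases l)
    case (Suc k)
    have "norm (x l - L) \<le> C / r * r ^ l"
      using *[of k] r by (simp add: Suc)
    also have "\<dots> \<le> max (C / r) (norm (x 0 - L)) * r ^ l"
      using r by (intro mult_right_mono) auto
    finally show ?thesis .
  qed simp
  moreover have "0 < max (C / r) (norm (x 0 - L))"
    using C r by (simp add: less_max_iff_disj)
  ultimately show ?thesis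
    unfolding converges_geometrically_def using r by (meson greaterThanLessThan_iff)
qed

section \<open>The power update as a positive matrix\<close>

text \<open>The reciprocal of the factor by which the objective multiplies the ratio of
  \<open>p $ m\<close> to its interference.\<close>

definition update_gain ::
  "nat \<Rightarrow> real ^ 'n \<Rightarrow> real ^ 'n \<Rightarrow> real ^ 'n ^ 'n \<Rightarrow> real ^ 'n \<Rightarrow> real ^ 'n \<Rightarrow> 'n::finite \<Rightarrow> real" where
  "update_gain N \<beta> w d q \<phi> m = - phi_deriv N w d q \<phi> $ m * \<beta> $ m / ((\<phi> $ m)\<^sup>2 * d $ m $ m)"

lemma power_update_nth:
  "power_update N \<beta> w \<sigma> d q \<phi> p $ m =
     update_gain N \<beta> w d q \<phi> m * interference N \<sigma> d q \<phi> p m"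
  by (simp add: power_update_def update_gain_def)

text \<open>The noise \<open>\<sigma> $ m\<close> is replaced by
  \<open>\<sigma> $ m * (w \<bullet> p) / (real N * P)\<close>, which is linear in \<open>p\<close>.
  This rank-one term also makes the diagonal positive, where there is no interference.\<close>

definition update_matrix ::
  "nat \<Rightarrow> real \<Rightarrow> real ^ 'n \<Rightarrow> real ^ 'n \<Rightarrow> real ^ 'n \<Rightarrow> real ^ 'n ^ 'n \<Rightarrow> real ^ 'n \<Rightarrow> real ^ 'n
    \<Rightarrow> real ^ 'n ^ 'n::finite" where
  "update_matrix N P \<beta> w \<sigma> d q \<phi> =
     (\<chi> m n. update_gain N \<beta> w d q \<phi> m *
        ((if n = m then 0 else 1 / real N * (d $ n $ m / (1 + q $ m * d $ n $ m * \<phi> $ n)\<^sup>2)) +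
         \<sigma> $ m * w $ n / (real N * P)))"

text \<open>The remainder is the noise not absorbed into the matrix: zero at full budget, which
  linearises the iteration, and nonnegative for feasible \<open>p\<close>, which serves the
  optimality proof.\<close>

lemma power_update_eq_matrix:
  "power_update N \<beta> w \<sigma> d q \<phi> p $ m =
     (update_matrix N P \<beta> w \<sigma> d q \<phi> *v p) $ m +
     update_gain N \<beta> w d q \<phi> m * \<sigma> $ m * (1 - w \<bullet> p / (real N * P))"
proof -
  have split: "(\<Sum>n\<in>UNIV. (if n = m then 0 else g n)) = sum g (UNIV - {m})" for g :: "'a \<Rightarrow> real"
    by (subst sum.remove[of _ m]) (auto intro!: sum.cong)
  have "(update_matrix N P \<beta> w \<sigma> d q \<phi> *v p) $ m =
    (\<Sum>n\<in>UNIV. update_gain N \<beta> w d q \<phi> m *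
       ((if n = m then 0 else 1 / real N * (p $ n * d $ n $ m / (1 + q $ m * d $ n $ m * \<phi> $ n)\<^sup>2)) +
        \<sigma> $ m / (real N * P) * (w $ n * p $ n)))"
    by (auto simp: matrix_vector_mult_def update_matrix_def algebra_simps intro!: sum.cong)
  also have "\<dots> = update_gain N \<beta> w d q \<phi> m *
      (1 / real N * (\<Sum>n\<in>UNIV - {m}. p $ n * d $ n $ m / (1 + q $ m * d $ n $ m * \<phi> $ n)\<^sup>2) +
       \<sigma> $ m / (real N * P) * (w \<bullet> p))"
    by (simp only: sum.distrib split inner_vec_def inner_real_def flip: sum_distrib_left)
  finally show ?thesis
    by (simp add: power_update_nth interference_def algebra_simps)
qed

lemma update_gain_pos:
  assumes "positive_vec \<beta>" "positive_vec w" "\<And>m n. 0 < d $ m $ n" "positive_vec q" "positive_vec \<phi>"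
  shows "0 < update_gain N \<beta> w d q \<phi> m"
proof -
  have "0 < w $ m + 1 / real N *
      (\<Sum>n\<in>UNIV - {m}. q $ n * d $ m $ n / (1 + q $ n * d $ m $ n * \<phi> $ m)\<^sup>2)"
    using assms by (intro add_pos_nonneg mult_nonneg_nonneg sum_nonneg)
      (auto simp: positive_vec_def less_imp_le)
  then show ?thesis
    using assms(1,5) assms(3)[of m m]
    by (simp add: update_gain_def phi_deriv_def positive_vec_def less_imp_neq[symmetric])
qed

lemma update_matrix_pos:
  assumes "0 < N" "0 < P" "positive_vec \<sigma>" "positive_vec \<beta>" "positive_vec w"
    "\<And>m n. 0 < d $ m $ n" "positive_vec q" "positive_vec \<phi>"
  shows "0 < update_matrix N P \<beta> w \<sigma> d q \<phi> $ m $ n"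
proof -
  have "0 < \<sigma> $ m * w $ n / (real N * P)"
    using assms by (simp add: positive_vec_def)
  moreover have "0 \<le> (if n = m then 0 else
      1 / real N * (d $ n $ m / (1 + q $ m * d $ n $ m * \<phi> $ n)\<^sup>2))"
    using assms(6)[of n m] by simp
  ultimately show ?thesis
    unfolding update_matrix_def vec_lambda_beta
    by (intro mult_pos_pos add_nonneg_pos update_gain_pos assms)
qed

lemma power_update_pos:
  assumes "positive_vec \<sigma>" "positive_vec \<beta>" "positive_vec w"
    "\<And>m n. 0 < d $ m $ n" "positive_vec q" "positive_vec \<phi>" "positive_vec p"
  shows "positive_vec (power_update N \<beta> w \<sigma> d q \<phi> p)"
proof -
  have "0 < interference N \<sigma> d q \<phi> p m" for m
    unfolding interference_def using assms
    by (intro add_pos_nonneg mult_nonneg_nonneg sum_nonneg) (auto simp: positive_vec_def less_imp_le)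
  then show ?thesis
    using update_gain_pos[OF assms(2-6)]
    by (simp add: positive_vec_def power_update_nth)
qed

lemma objective_eq_Min_ratio:
  "objective N \<beta> w \<sigma> d q \<phi> p =
     Min (range (\<lambda>m. p $ m / power_update N \<beta> w \<sigma> d q \<phi> p $ m))"
  unfolding objective_def power_update_def
  by (intro arg_cong[where f = Min] image_cong refl) (simp add: mult_ac)

section \<open>Optimality of the Perron vector and convergence to it\<close>

theorem theorem3:
  fixes J K N :: nat
    and P :: real
    and \<beta> w \<sigma> q \<phi> :: "real ^ 'n::finite"
    and d :: "real ^ 'n ^ 'n"
    and p :: "nat \<Rightarrow> real ^ 'n"
  assumes "0 < J" and "0 < K" and "0 < N"
    and "CARD('n) = J * K"
    and "0 < P"
    and "positive_vec \<beta>" and "positive_vec w" and "positive_vec \<sigma>"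
    and "\<And>m n. 0 < d $ m $ n"
    and "positive_vec q" and "positive_vec \<phi>"
    and "positive_vec (p 0)" and "1 / real N * (w \<bullet> p 0) \<le> P"
    and "\<And>l. p (Suc l) = rescale N P w (power_update N \<beta> w \<sigma> d q \<phi> (p l))"
  shows "\<exists>p_opt.
    (\<forall>x. is_arg_max (objective N \<beta> w \<sigma> d q \<phi>) (feasible N P w) x \<longleftrightarrow> x = p_opt) \<and>
    converges_geometrically p p_opt"
proof -
  define c where "c = real N * P"
  define B where "B = update_matrix N P \<beta> w \<sigma> d q \<phi>"
  define T where "T = power_update N \<beta> w \<sigma> d q \<phi>"
  define f where "f = objective N \<beta> w \<sigma> d q \<phi>"
  define h where "h = (\<lambda>m. update_gain N \<beta> w d q \<phi> m * \<sigma> $ m)"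
  have c: "0 < c"
    using assms by (simp add: c_def)
  have B: "0 < B $ i $ j" for i j
    unfolding B_def by (intro update_matrix_pos assms)
  have h: "0 < h m" for m
    using update_gain_pos[of \<beta> w d q \<phi> N m] assms by (simp add: h_def positive_vec_def)
  have T: "T y $ m = (B *v y) $ m + h m * (1 - w \<bullet> y / c)" for y m
    unfolding T_def B_def h_def c_def by (rule power_update_eq_matrix)
  have T_pos: "positive_vec (T y)" if "positive_vec y" for y
    unfolding T_def by (intro power_update_pos assms that)
  have T_eq: "T y = B *v y" if "w \<bullet> y = c" for y
    using that c by (simp add: vec_eq_iff T)
  have feas: "feasible N P w y \<longleftrightarrow> w \<bullet> y \<le> c \<and> positive_vec y" for y
    using \<open>0 < N\<close> by (simp add: feasible_def c_def field_simps)
  have f: "f y = Min (range (\<lambda>m. y $ m / T y $ m))" for y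
    unfolding f_def T_def by (rule objective_eq_Min_ratio)
  obtain v \<mu> where v: "positive_vec v" "0 < \<mu>" "w \<bullet> v = c" "B *v v = \<mu> *\<^sub>R v"
    using positive_matrix_perron_vector[OF B \<open>positive_vec w\<close> c] by blast
  \<comment> \<open>At \<open>v\<close> all ratios in the minimum are balanced, since
    \<open>v\<close> exhausts the budget and \<open>T\<close> acts on it as
    \<open>B\<close>.\<close>
  have "v $ m / T v $ m = 1 / \<mu>" for m
    using v(1)[unfolded positive_vec_def, rule_format, of m] by (simp add: T_eq v)
  then have fv: "f v = 1 / \<mu>"
    by (simp add: f)
  \<comment> \<open>This one claim gives both maximality of \<open>v\<close> and uniqueness: a
    strictly better competitor would equal \<open>v\<close> as well.\<close>
  have opt: "y = v" if y: "feasible N P w y" "f v \<le> f y" for y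
  proof -
    have yp: "positive_vec y" and yc: "w \<bullet> y \<le> c"
      using y(1) by (simp_all add: feas)
    have le: "T y $ m \<le> \<mu> * y $ m" for m
    proof -
      have "f y \<le> y $ m / T y $ m"
        by (simp add: f)
      then have "1 / \<mu> \<le> y $ m / T y $ m"
        using y(2) fv by simp
      then show ?thesis
        using T_pos[OF yp] v(2) by (simp add: positive_vec_def field_simps)
    qed
    have slack: "0 \<le> 1 - w \<bullet> y / c"
      using yc c by simp
    have "(B *v y) $ m \<le> \<mu> * y $ m" for m
      using le[of m] T[of y m] mult_nonneg_nonneg[OF less_imp_le[OF h[of m]] slack] by linarith
    then obtain s where s: "y = s *\<^sub>R v"
      using subeigenvector_multiple_of_perron_vector[OF B v(1,4)] by blast
    fix k :: 'n
    \<comment> \<open>For \<open>y = s *\<^sub>R v\<close> the linear parts of \<open>le\<close>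
      cancel and only the noise remainder is left. It forces \<open>s\<close> to be at least 1,
      while the budget forces it to be at most 1.\<close>
    have "h k * (1 - s) \<le> 0"
      using le[of k] c by (simp add: T s matrix_vector_mult_scaleR v)
    then have "1 \<le> s"
      using h[of k] by (simp add: mult_le_0_iff)
    moreover have "s \<le> 1"
      using yc c by (simp add: s v)
    ultimately show ?thesis
      by (simp add: s)
  qed
  have "is_arg_max f (feasible N P w) y \<longleftrightarrow> y = v" for y
  proof
    assume "is_arg_max f (feasible N P w) y"
    moreover have "feasible N P w v"
      by (simp add: feas v)
    ultimately show "y = v"
      by (intro opt) (auto simp: is_arg_max_def not_less)
  next
    assume "y = v"
    moreover have "\<not> f v < f x" if "feasible N P w x" for x
      using opt[OF that] by (cases "f v < f x") auto
    ultimately show "is_arg_max f (feasible N P w) y"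
      by (auto simp: is_arg_max_def feas v)
  qed
  moreover have "converges_geometrically p v"
  proof (rule converges_geometrically_Suc)
    have step: "p (Suc l) = (c / (w \<bullet> T (p l))) *\<^sub>R T (p l)" for l
      using assms(14) by (simp add: rescale_def c_def T_def)
    have p_pos: "positive_vec (p l)" for l
    proof (induction l)
      case 0
      show ?case by (rule assms)
    next
      case (Suc l)
      then show ?case
        using T_pos[OF Suc] positive_vec_inner_pos[OF \<open>positive_vec w\<close> T_pos[OF Suc]] c
        by (simp add: step positive_vec_def)
    qed
    \<comment> \<open>Rescaling puts every iterate after the initial one on the hyperplane where
      \<open>T\<close> agrees with \<open>B\<close>.\<close>
    have wp: "w \<bullet> p (Suc l) = c" for l
      using positive_vec_inner_pos[OF \<open>positive_vec w\<close> T_pos[OF p_pos[of l]]] by (simp add: step)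
    show "converges_geometrically (\<lambda>l. p (Suc l)) v"
    proof (rule normalised_power_iteration_converges[OF B \<open>positive_vec w\<close> c v])
      show "p (Suc (Suc l)) = (c / (w \<bullet> (B *v p (Suc l)))) *\<^sub>R (B *v p (Suc l))" for l
        using step[of "Suc l"] by (simp add: T_eq[OF wp])
    qed (use p_pos wp in auto)
  qed
  ultimately show ?thesis
    unfolding f_def by blast
qed

end
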